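(* Let $0<|q|<1$, let $N,n,m$ be integers with $N\ge n\ge m>0$, and let $a,b,c\in\mathbb{C}$ be such that no denominator below vanishes. Then \[ {}_8W_7\!\left(abq;\,bq,\,aq/c,\,abq^{N+2},\,q^{-n},\,q^{-m};\,q,\,cq^{m+n-N}\right) \] \[ =\frac{(cq^{n-N}/a,\;q^{n-N}/b;q)_{N-n}\,(abq^2,\;q^{-n},\;cq^{n-N};q)_m}{(q^{-1-N}/(ab),\;cq^{2n-N+1};q)_{N-n}\,(aq,\;q^{-N},\;bcq;q)_m}\; {}_8W_7\!\left(cq^{2n-N};\,cq^{m+n-N},\,q^{1+n},\,aq^{1+n},\,bcq^{1+n},\,q^{n-N};\,q,\,\frac{1}{abq^{1+n+m}}\right). \]
   Context: $(x;q)_k=\prod_{j=0}^{k-1}(1-xq^j)$ for integers $k\ge0$, $(x_1,\dots,x_r;q)_k=\prod_i(x_i;q)_k$. The very-well-poised series is \[ {}_{r+1}W_r(a_1;a_4,\dots,a_{r+1};q,z)=\sum_{k\ge0}\frac{1-a_1q^{2k}}{1-a_1}\,\frac{(a_1,a_4,\dots,a_{r+1};q)_k}{(q,a_1q/a_4,\dots,a_1q/a_{r+1};q)_k}\,z^k; \] both series above terminate (because of the parameters $q^{-m}$ resp. $q^{n-N}$). The paper presents this as the dual form of the orthogonality relation of the $q$-Racah polynomials. *)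

theory Defs
  imports Complex_Main
begin

definition qpoch :: "complex \<Rightarrow> complex \<Rightarrow> nat \<Rightarrow> complex" where
  "qpoch x q k = (\<Prod>j<k. 1 - x * q ^ j)"

definition qpochs :: "complex list \<Rightarrow> complex \<Rightarrow> nat \<Rightarrow> complex" where
  "qpochs xs q k = (\<Prod>x\<leftarrow>xs. qpoch x q k)"

(* The very-well-poised series W(a1; as; q, z); with as = [a_4, ..., a_{r+1}] it is the
   {r+1}W_r of the literature, so five parameters in the list give 8W7.
   If some member of as is q^(-K), every term with k > K has a vanishing numerator,
   hence is 0 whatever its denominator (x / 0 = 0), and the series is a finite sum over k <= K. *)

definition vwp_denoms :: "complex \<Rightarrow> complex list \<Rightarrow> complex \<Rightarrow> complex list" where
  "vwp_denoms a1 as q = q # map (\<lambda>x. a1 * q / x) as"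

definition vwp_W :: "complex \<Rightarrow> complex list \<Rightarrow> complex \<Rightarrow> complex \<Rightarrow> complex" where
  "vwp_W a1 as q z =
     (\<Sum>k. (1 - a1 * q ^ (2 * k)) / (1 - a1) *
           (qpochs (a1 # as) q k / qpochs (vwp_denoms a1 as q) q k) * z ^ k)"

(* No denominator vanishes in the terms k <= K of vwp_W a1 as q z.  The bound K is needed for
   terminating series: denominators beyond the point of termination may well be zero. *)

definition vwp_defined_upto :: "complex \<Rightarrow> complex list \<Rightarrow> complex \<Rightarrow> nat \<Rightarrow> bool" where
  "vwp_defined_upto a1 as q K \<longleftrightarrow>
     a1 \<noteq> 1 \<and> (\<forall>x\<in>set as. x \<noteq> 0) \<and> (\<forall>k\<le>K. qpochs (vwp_denoms a1 as q) q k \<noteq> 0)"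

end

theory Submission
  imports Defs
begin

text \<open>Watson's transformation turns both sides into terminating balanced \<open>4\<phi>3\<close> series whose
  numerators share the parameters \<open>q^(-m)\<close> and \<open>q^(n-N)\<close>, and Sears' transformation maps one
  of them to the other. Both follow from the \<open>q\<close>-Saalschuetz sum by an exchange of summations:
  Sears by applying it twice, Watson by inserting it into a very-well-poised sum
  (Bailey's method), which reduces \<open>8W7\<close> to \<open>6W5\<close> and \<open>6W5\<close> to a telescoping sum.
  The hypotheses allow \<open>c = q^(-i)\<close> and \<open>abq^2 = q^(-i)\<close>, where the usual \<open>4\<phi>3\<close> forms
  divide by zero, so the sums are kept in convolution form, with factors of index \<open>m - k\<close>
  in place of reversed denominators.\<close>

section \<open>Shifted factorials: splitting, reversal and negative powers of
  \<open>q\<close>\<close>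

lemma qpoch_0 [simp]: "qpoch x q 0 = 1"
  by (simp add: qpoch_def)

lemma qpoch_Suc: "qpoch x q (Suc k) = qpoch x q k * (1 - x * q ^ k)"
  by (simp add: qpoch_def)

lemma qpoch_add: "qpoch x q (i + j) = qpoch x q i * qpoch (x * q ^ i) q j"
  by (induction j) (simp_all add: qpoch_Suc power_add mult.assoc)

lemma qpoch_split: "j \<le> k \<Longrightarrow> qpoch x q k = qpoch x q j * qpoch (x * q ^ j) q (k - j)"
  using qpoch_add[of x q j "k - j"] by simp

lemma qpoch_nonzero_mono: "qpoch x q n \<noteq> 0 \<Longrightarrow> k \<le> n \<Longrightarrow> qpoch x q k \<noteq> 0"
  using qpoch_split[of k n x q] by auto

lemma qpoch_self_nonzero:
  assumes "\<And>k. k > 0 \<Longrightarrow> q ^ k \<noteq> 1"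
  shows "qpoch q q k \<noteq> 0"
  using assms by (induction k) (auto simp: qpoch_Suc simp flip: power_Suc)

lemma qpoch_inverse_power_eq_0:
  assumes "q \<noteq> 0" "m < k"
  shows "qpoch (1 / q ^ m) q k = 0"
  using assms qpoch_split[of "Suc m" k "1 / q ^ m" q] by (simp add: qpoch_Suc)

lemma choose_two_add: "(i + j) choose 2 = (i choose 2) + (j choose 2) + i * j"
  by (induction j) (simp_all add: numeral_2_eq_2)

lemma choose_two_Suc: "Suc k choose 2 = (k choose 2) + k"
  by (simp add: numeral_2_eq_2)

text \<open>Read backwards, each factor \<open>1 - q^(-i)/y\<close> with \<open>i < n\<close> equals
  \<open>(-1/y) * q^(-i) * (1 - y*q^i)\<close>, and the exponents \<open>i\<close> add up to
  \<open>n choose 2\<close>.\<close>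

lemma qpoch_reverse:
  assumes "q \<noteq> 0" "y \<noteq> 0"
  shows "qpoch (q / (y * q ^ n)) q n = (- 1 / y) ^ n / q ^ (n choose 2) * qpoch y q n"
proof (induction n)
  case (Suc n)
  have "qpoch (q / (y * q ^ Suc n)) q (Suc n)
      = (1 - q / (y * q ^ Suc n)) * qpoch (q / (y * q ^ n)) q n"
    using qpoch_add[of "q / (y * q ^ Suc n)" q 1 n] assms by (simp add: qpoch_Suc)
  also have "\<dots> = (1 - 1 / (y * q ^ n)) * ((- 1 / y) ^ n / q ^ (n choose 2) * qpoch y q n)"
    using Suc assms by simp
  also have "\<dots> = (- 1 / y) ^ Suc n / q ^ (Suc n choose 2) * qpoch y q (Suc n)"
  proof -
    have e: "1 - 1 / (y * q ^ n) = (- 1 / y) / q ^ n * (1 - y * q ^ n)"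
      using assms by (simp add: field_simps)
    show ?thesis
      unfolding e choose_two_Suc qpoch_Suc power_add by (simp add: mult_ac)
  qed
  finally show ?case .
qed (simp add: numeral_2_eq_2)

text \<open>The factor of index \<open>j\<close> is \<open>-q^(j-m) * (1 - q^(m-j))\<close>, and the
  last brackets multiply to a quotient of \<open>q\<close>-factorials. This trades a terminating
  parameter for the factor \<open>1 / (q;q)_(m-k)\<close> of the convolution form.\<close>

lemma qpoch_inverse_power:
  assumes "q \<noteq> 0" "\<And>k. k > 0 \<Longrightarrow> q ^ k \<noteq> 1" "k \<le> m"
  shows "qpoch (1 / q ^ m) q k
    = (- 1) ^ k * q ^ (k choose 2) / q ^ (m * k) * (qpoch q q m / qpoch q q (m - k))"
  using \<open>k \<le> m\<close>
proof (induction k)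
  case 0
  then show ?case using qpoch_self_nonzero assms by (simp add: numeral_2_eq_2)
next
  case (Suc k)
  then obtain d where d: "m = Suc (d + k)"
    by (metis add.commute add_Suc le_Suc_ex)
  have nz: "qpoch q q j \<noteq> 0" for j using qpoch_self_nonzero[OF assms(2)] .
  have nz': "1 - q ^ Suc d \<noteq> 0" using assms(2)[of "Suc d"] by simp
  have e: "m - k = Suc d" "m - Suc k = d" using d by auto
  have f: "1 - 1 / q ^ m * q ^ k = - (1 - q ^ Suc d) * q ^ k / q ^ m"
    using \<open>q \<noteq> 0\<close> by (simp add: d field_simps power_add)
  have g: "qpoch q q (Suc d) = qpoch q q d * (1 - q ^ Suc d)"
    by (simp add: qpoch_Suc)
  have IH: "qpoch (1 / q ^ m) q k
     = (- 1) ^ k * q ^ (k choose 2) / q ^ (m * k) * (qpoch q q m / qpoch q q (Suc d))"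
    using Suc e by simp
  have "qpoch (1 / q ^ m) q (Suc k)
     = (- 1) ^ k * q ^ (k choose 2) / q ^ (m * k) * (qpoch q q m / qpoch q q (Suc d))
        * (- (1 - q ^ Suc d) * q ^ k / q ^ m)"
    by (simp only: qpoch_Suc f IH)
  also have "\<dots> = (- 1) ^ Suc k * q ^ (Suc k choose 2) / q ^ (m * Suc k)
        * (qpoch q q m / qpoch q q d)"
    unfolding g choose_two_Suc power_add mult_Suc_right
    using nz'
    by (simp add: divide_simps nz assms(1)) (simp add: algebra_simps)
  finally show ?case using e by simp
qed

section \<open>Exchange of summations and the q-Saalschuetz sum\<close>

lemma sum_triangle_shift:
  fixes f :: "nat \<Rightarrow> nat \<Rightarrow> 'a::comm_monoid_add"
  shows "(\<Sum>k\<le>m. \<Sum>j\<le>k. f k j) = (\<Sum>j\<le>m. \<Sum>i\<le>m - j. f (j + i) j)"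
  unfolding sum.Sigma[OF finite_atMost ballI[OF finite_atMost]]
  by (rule sum.reindex_bij_witness[where i = "\<lambda>(j, i). (j + i, j)" and j = "\<lambda>(k, j). (j, k - j)"])
     auto

text \<open>Zeilberger's certificate behind the telescoping in the next proof, with
  \<open>x = q ^ j\<close> and \<open>y = q ^ (k - j)\<close>.\<close>

lemma saalschuetz_certificate:
  fixes q \<alpha> \<beta> \<delta> x y :: complex
  shows "(1 - q * (x * y)) * (1 - \<alpha> * \<beta> * \<delta> * (x * y)) * (1 - \<delta> * y)
      - (1 - \<alpha> * \<delta> * (x * y)) * (1 - \<beta> * \<delta> * (x * y)) * (1 - q * y)
      = - (y * (1 - \<alpha> * x) * (1 - \<beta> * x) * \<delta>) * (1 - q * y)
        + y * (1 - x) * (q - \<alpha> * \<beta> * \<delta> * x) * (1 - \<delta> * y)"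
  by (simp add: algebra_simps)

text \<open>Division by the \<open>q\<close>-factorials turns the terminating Saalschuetz sum into a convolution
  in which no power of \<open>q\<close> with negative exponent occurs.\<close>

lemma q_saalschuetz:
  assumes q: "q \<noteq> 0" "\<And>k. k > 0 \<Longrightarrow> q ^ k \<noteq> 1" and "qpoch (\<alpha> * \<beta> * \<delta>) q k \<noteq> 0"
  shows "(\<Sum>j\<le>k. qpoch \<alpha> q j * qpoch \<beta> q j / (qpoch q q j * qpoch (\<alpha> * \<beta> * \<delta>) q j)
            * (qpoch \<delta> q (k - j) / qpoch q q (k - j)) * \<delta> ^ j)
       = qpoch (\<alpha> * \<delta>) q k * qpoch (\<beta> * \<delta>) q k / (qpoch q q k * qpoch (\<alpha> * \<beta> * \<delta>) q k)"
  using assms(3)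
proof (induction k)
  case (Suc k)
  define \<gamma> where "\<gamma> = \<alpha> * \<beta> * \<delta>"
  define u where "u k j = qpoch \<alpha> q j * qpoch \<beta> q j / (qpoch q q j * qpoch \<gamma> q j)
            * (qpoch \<delta> q (k - j) / qpoch q q (k - j)) * \<delta> ^ j" for k j
  \<comment> \<open>\<open>G j\<close> is \<open>u (Suc k) j\<close> times the certificate
    \<open>-q^(k+1-j) * (1 - q^j) * (1 - \<gamma> * q^(j-1))\<close>. For \<open>j > 0\<close> the
    last two factors cancel the final factors of the denominators \<open>(q;q)_j\<close> and
    \<open>(\<gamma>;q)_j\<close>.\<close>
  define G where "G j = - (q ^ Suc k / q ^ j) * (1 - q ^ j) * (1 - \<gamma> * q ^ j / q) *
      (qpoch \<alpha> q j * qpoch \<beta> q j / (qpoch q q j * qpoch \<gamma> q j)) *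
      (qpoch \<delta> q (Suc k - j) / qpoch q q (Suc k - j)) * \<delta> ^ j" for j
  have gn: "qpoch \<gamma> q j \<noteq> 0" if "j \<le> Suc k" for j
    using qpoch_nonzero_mono[OF Suc.prems that] unfolding \<gamma>_def .
  \<comment> \<open>The quotient \<open>s / r\<close> is the ratio of the closed form at
    \<open>k + 1\<close> to that at \<open>k\<close>, so it suffices to show that the sums satisfy
    the same first-order recurrence.\<close>
  define s where "s = (1 - \<alpha> * \<delta> * q ^ k) * (1 - \<beta> * \<delta> * q ^ k)"
  define r where "r = (1 - q ^ Suc k) * (1 - \<gamma> * q ^ k)"
  have step: "r * u (Suc k) j - s * u k j = G (Suc j) - G j" if jk: "j \<le> k" for j
  proof -
    obtain d where d: "k = j + d" using le_Suc_ex[OF jk] by blast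
    define P where "P = qpoch \<alpha> q j * qpoch \<beta> q j / (qpoch q q j * qpoch \<gamma> q j)
            * (qpoch \<delta> q d / qpoch q q d) * \<delta> ^ j"
    have nzd: "1 - q * q ^ d \<noteq> 0" "1 - q * q ^ j \<noteq> 0"
      using q(2)[of "Suc d"] q(2)[of "Suc j"] by simp_all
    have gnj: "1 - \<gamma> * q ^ j \<noteq> 0" using gn[of "Suc j"] jk by (simp add: qpoch_Suc)
    have 1: "u k j = P" by (simp add: u_def P_def d)
    have 2: "u (Suc k) j = P * (1 - \<delta> * q ^ d) / (1 - q * q ^ d)"
      by (simp add: u_def P_def d Suc_diff_le qpoch_Suc mult_ac)
    have 3: "G (Suc j) = - (q ^ d * (1 - \<alpha> * q ^ j) * (1 - \<beta> * q ^ j) * \<delta>) * P"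
      using nzd gnj q by (simp add: G_def P_def d qpoch_Suc power_add)
    have 4: "G j = - (q * q ^ d * (1 - q ^ j) * (1 - \<gamma> * q ^ j / q)
        * (1 - \<delta> * q ^ d) / (1 - q * q ^ d)) * P"
      using q by (simp add: G_def P_def d Suc_diff_le qpoch_Suc power_add mult_ac)
    have core: "r * (1 - \<delta> * q ^ d) - s * (1 - q * q ^ d)
      = - (q ^ d * (1 - \<alpha> * q ^ j) * (1 - \<beta> * q ^ j) * \<delta>) * (1 - q * q ^ d)
        + q ^ d * (1 - q ^ j) * (q - \<gamma> * q ^ j) * (1 - \<delta> * q ^ d)"
      using saalschuetz_certificate[of q "q ^ j" "q ^ d" \<alpha> \<beta> \<delta>]
      by (simp only: r_def s_def \<gamma>_def d power_add power_Suc)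
    have "r * (1 - \<delta> * q ^ d) / (1 - q * q ^ d) - s
      = - (q ^ d * (1 - \<alpha> * q ^ j) * (1 - \<beta> * q ^ j) * \<delta>)
        + q * q ^ d * (1 - q ^ j) * (1 - \<gamma> * q ^ j / q) * (1 - \<delta> * q ^ d) / (1 - q * q ^ d)"
    proof -
      have "q * (1 - \<gamma> * q ^ j / q) = q - \<gamma> * q ^ j" using q(1) by (simp add: field_simps)
      moreover have "q * q ^ d * (1 - q ^ j) * z * (1 - \<delta> * q ^ d)
        = q ^ d * (1 - q ^ j) * (q * z) * (1 - \<delta> * q ^ d)" for z
        by (simp only: mult_ac)
      ultimately have e: "q * q ^ d * (1 - q ^ j) * (1 - \<gamma> * q ^ j / q) * (1 - \<delta> * q ^ d)
        = q ^ d * (1 - q ^ j) * (q - \<gamma> * q ^ j) * (1 - \<delta> * q ^ d)"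
        by simp
      have "r * (1 - \<delta> * q ^ d) / (1 - q * q ^ d) - s
        = (r * (1 - \<delta> * q ^ d) - s * (1 - q * q ^ d)) / (1 - q * q ^ d)"
        using nzd by (simp add: diff_divide_distrib)
      then show ?thesis unfolding core e using nzd by (simp add: add_divide_distrib diff_divide_distrib)
    qed
    then have "(r * (1 - \<delta> * q ^ d) / (1 - q * q ^ d) - s) * P = G (Suc j) - G j"
      unfolding 3 4 by (simp only: distrib_right diff_minus_eq_add mult_minus_left)
    moreover have "r * u (Suc k) j - s * u k j = (r * (1 - \<delta> * q ^ d) / (1 - q * q ^ d) - s) * P"
      unfolding 1 2 by (simp only: left_diff_distrib) (simp add: mult_ac)
    ultimately show ?thesis by simp
  qed
  have "(\<Sum>j\<le>k. r * u (Suc k) j - s * u k j) = (\<Sum>j<Suc k. G (Suc j) - G j)"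
    unfolding lessThan_Suc_atMost by (rule sum.cong) (use step in auto)
  also have "\<dots> = G (Suc k) - G 0" by (rule sum_lessThan_telescope)
  \<comment> \<open>\<open>G 0\<close> vanishes through \<open>1 - q^0\<close>. The value at
    \<open>k + 1\<close> supplies the term \<open>j = k + 1\<close>, which the sum for
    \<open>k + 1\<close> has and the sum for \<open>k\<close> lacks.\<close>
  also have "\<dots> = - r * u (Suc k) (Suc k)"
  proof -
    define w where "w = 1 - q * q ^ k"
    show ?thesis using q(1) by (simp add: G_def u_def r_def mult_ac flip: w_def)
  qed
  finally have *: "r * (\<Sum>j\<le>Suc k. u (Suc k) j) = s * (\<Sum>j\<le>k. u k j)"
    by (simp add: sum_subtractf distrib_left flip: sum_distrib_left) (simp add: diff_eq_eq)
  have "(\<Sum>j\<le>k. u k j)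
      = qpoch (\<alpha> * \<delta>) q k * qpoch (\<beta> * \<delta>) q k / (qpoch q q k * qpoch \<gamma> q k)"
    using Suc.IH gn[of k] unfolding u_def \<gamma>_def by simp
  moreover have "r \<noteq> 0"
    using gn[of "Suc k"] q(2)[of "Suc k"] by (auto simp: r_def qpoch_Suc)
  ultimately have "(\<Sum>j\<le>Suc k. u (Suc k) j)
      = s * (qpoch (\<alpha> * \<delta>) q k * qpoch (\<beta> * \<delta>) q k / (qpoch q q k * qpoch \<gamma> q k)) / r"
    using * by (metis nonzero_mult_div_cancel_left)
  also have "\<dots> = qpoch (\<alpha> * \<delta>) q (Suc k) * qpoch (\<beta> * \<delta>) q (Suc k)
      / (qpoch q q (Suc k) * qpoch \<gamma> q (Suc k))"
    by (simp add: qpoch_Suc s_def r_def mult_ac)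
  finally show ?case unfolding u_def \<gamma>_def .
qed simp

section \<open>Bailey's method: from Saalschuetz to 6W5 and 8W7\<close>

text \<open>Saalschuetz with \<open>\<alpha> = A*q^k\<close>, \<open>\<beta> = g\<close> and the
  \<open>k\<close>-dependent \<open>\<delta> = C/(A*q^k)\<close> has
  \<open>\<alpha>*\<delta> = C\<close> and \<open>\<alpha>*\<beta>*\<delta> = A*q/B\<close>, while
  \<open>\<beta>*\<delta> = q/(B*q^k)\<close> reverses to \<open>(B;q)_k\<close>. Thus one
  well-poised pair \<open>B\<close>, \<open>C\<close> is expanded as a sum over
  \<open>j\<close>.\<close>

lemma q_saalschuetz_inverted:
  assumes q: "q \<noteq> 0" "\<And>k. k > 0 \<Longrightarrow> q ^ k \<noteq> 1"
    and nz: "A \<noteq> 0" "B \<noteq> 0" "C \<noteq> 0"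
    and den: "qpoch (A * q / B) q k \<noteq> 0" "qpoch (A * q / C) q k \<noteq> 0"
    and g: "g = A * q / (B * C)"
  shows "qpoch B q k * qpoch C q k * g ^ k / (qpoch (A * q / B) q k * qpoch (A * q / C) q k)
    = (\<Sum>j\<le>k. (- 1) ^ j * q ^ (j choose 2) * q ^ j / q ^ (k * j)
        * (qpoch q q k / qpoch q q (k - j)) * (qpoch (A * q ^ k) q j * qpoch g q j)
        / (qpoch q q j * qpoch (A * q / B) q j * qpoch (A * q / C) q j))"
    (is "?lhs = (\<Sum>j\<le>k. ?f j)")
proof -
  define \<delta> where "\<delta> = C / (A * q ^ k)"
  \<comment> \<open>The powers in \<open>K\<close> compensate the reversal of
    \<open>(q/(B*q^k);q)_k\<close>: together with \<open>(-1/B)^k / q^(k choose 2)\<close> they give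
    \<open>g^k\<close>.\<close>
  define K where "K = (- (A / C * q)) ^ k * q ^ (k choose 2) * qpoch q q k / qpoch (A * q / C) q k"
  have qq: "qpoch q q j \<noteq> 0" for j using qpoch_self_nonzero[OF q(2)] .
  have e: "A * q ^ k * g * \<delta> = A * q / B" "A * q ^ k * \<delta> = C" "g * \<delta> = q / (B * q ^ k)"
    using q nz by (simp_all add: \<delta>_def g)
  have "K * (\<Sum>j\<le>k. qpoch (A * q ^ k) q j * qpoch g q j / (qpoch q q j * qpoch (A * q / B) q j)
            * (qpoch \<delta> q (k - j) / qpoch q q (k - j)) * \<delta> ^ j)
      = K * (qpoch C q k * qpoch (q / (B * q ^ k)) q k / (qpoch q q k * qpoch (A * q / B) q k))"
    using q_saalschuetz[OF q, of "A * q ^ k" g \<delta> k] den by (simp add: e)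
  also have "\<dots> = ?lhs"
  proof -
    have "(- (A / C * q)) ^ k * (- 1 / B) ^ k = g ^ k"
      unfolding power_mult_distrib[symmetric] by (simp add: g mult_ac)
    then show ?thesis
      unfolding qpoch_reverse[OF q(1) nz(2)] K_def
      using q(1) qq[of k] by (simp add: field_simps)
  qed
  finally have "?lhs = (\<Sum>j\<le>k. K * (qpoch (A * q ^ k) q j * qpoch g q j
      / (qpoch q q j * qpoch (A * q / B) q j) * (qpoch \<delta> q (k - j) / qpoch q q (k - j)) * \<delta> ^ j))"
    by (simp add: sum_distrib_left)
  also have "\<dots> = (\<Sum>j\<le>k. ?f j)"
  proof (rule sum.cong)
    fix j assume "j \<in> {..k}"
    then obtain d where d: "k = j + d" using le_Suc_ex by auto
    \<comment> \<open>With this \<open>y\<close> the factor \<open>(\<delta>;q)_(k-j)\<close>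
      reverses to \<open>(y;q)_d\<close>, the tail of \<open>(A*q/C;q)_k\<close>, which then cancels
      against the denominator of \<open>K\<close>.\<close>
    define y where "y = A * q / C * q ^ j"
    have y: "y \<noteq> 0" "\<delta> = q / (y * q ^ d)"
      using q nz by (simp_all add: y_def \<delta>_def d power_add)
    have s: "qpoch (A * q / C) q k = qpoch (A * q / C) q j * qpoch y q d"
      unfolding d qpoch_add y_def ..
    have sgn: "(- 1) ^ d * (- 1) ^ d = (1 :: complex)"
      by (simp flip: power_mult_distrib)
    have "(- (A / C * q)) ^ k * q ^ (k choose 2) * ((- 1 / y) ^ d / q ^ (d choose 2)) * \<delta> ^ j
      = (- 1) ^ j * ((- 1) ^ d * (- 1) ^ d) * (q ^ (j choose 2) * q ^ j / q ^ (k * j))"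
      unfolding d choose_two_add y_def \<delta>_def power_minus[of "A / C * q"]
        power_minus[of "1 / _"] minus_divide_left[symmetric]
      using q(1) nz
      by (simp add: field_simps power_add power_mult_distrib power_divide flip: power_mult)
    then have "(- (A / C * q)) ^ k * q ^ (k choose 2) * ((- 1 / y) ^ d / q ^ (d choose 2)) * \<delta> ^ j
      = (- 1) ^ j * (q ^ (j choose 2) * q ^ j / q ^ (k * j))" (is "?c = ?c'")
      unfolding sgn by simp
    then have *: "?c * X = ?c' * X" for X by simp
    have "qpoch \<delta> q (k - j) = (- 1 / y) ^ d / q ^ (d choose 2) * qpoch y q d"
      using qpoch_reverse[OF q(1) y(1), of d] by (simp add: y(2) d)
    then show "K * (qpoch (A * q ^ k) q j * qpoch g q j
      / (qpoch q q j * qpoch (A * q / B) q j) * (qpoch \<delta> q (k - j) / qpoch q q (k - j)) * \<delta> ^ j) = ?f j"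
      using *[of "qpoch q q k / qpoch q q (k - j) * (qpoch (A * q ^ k) q j * qpoch g q j)
        / (qpoch q q j * qpoch (A * q / B) q j * qpoch (A * q / C) q j)"] den(2)
      unfolding K_def s by (simp add: mult_ac)
  qed simp
  finally show ?thesis .
qed

text \<open>Expand the pair \<open>B\<close>, \<open>C\<close> by
  \<open>q_saalschuetz_inverted\<close>, exchange the sums and put \<open>k = j + i\<close>: the
  inner sum is again very-well-poised, with \<open>A\<close> replaced by \<open>A*q^(2*j)\<close>.
  The weight \<open>\<phi>\<close> stays arbitrary, so that it may be the termination factor alone
  or contain a second pair.\<close>

lemma bailey_swap:
  assumes q: "q \<noteq> 0" "\<And>k. k > 0 \<Longrightarrow> q ^ k \<noteq> 1"
    and nz: "A \<noteq> 0" "B \<noteq> 0" "C \<noteq> 0"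
    and den: "qpoch (A * q / B) q m \<noteq> 0" "qpoch (A * q / C) q m \<noteq> 0"
    and g: "g = A * q / (B * C)"
  shows "(\<Sum>k\<le>m. (1 - A * q ^ (2 * k)) * qpoch A q k * (- 1) ^ k * q ^ (k choose 2) / qpoch q q k
      * (qpoch B q k * qpoch C q k * g ^ k / (qpoch (A * q / B) q k * qpoch (A * q / C) q k))
      * \<phi> k)
    = (\<Sum>j\<le>m. qpoch g q j * qpoch A q (2 * j)
        / (qpoch q q j * qpoch (A * q / B) q j * qpoch (A * q / C) q j)
        * (\<Sum>i\<le>m - j. (1 - A * q ^ (2 * j) * q ^ (2 * i)) * qpoch (A * q ^ (2 * j)) q i
             * (- 1) ^ i * q ^ (i choose 2) / qpoch q q i * \<phi> (j + i)))"
    (is "(\<Sum>k\<le>m. ?w k * _ * \<phi> k) = ?rhs")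
proof -
  define f where "f k j = ?w k * ((- 1) ^ j * q ^ (j choose 2) * q ^ j / q ^ (k * j)
        * (qpoch q q k / qpoch q q (k - j)) * (qpoch (A * q ^ k) q j * qpoch g q j)
        / (qpoch q q j * qpoch (A * q / B) q j * qpoch (A * q / C) q j)) * \<phi> k" for k j
  have qq: "qpoch q q j \<noteq> 0" for j using qpoch_self_nonzero[OF q(2)] .
  have "(\<Sum>k\<le>m. ?w k
      * (qpoch B q k * qpoch C q k * g ^ k / (qpoch (A * q / B) q k * qpoch (A * q / C) q k))
      * \<phi> k) = (\<Sum>k\<le>m. \<Sum>j\<le>k. f k j)"
  proof (rule sum.cong)
    fix k assume "k \<in> {..m}"
    then have "qpoch (A * q / B) q k \<noteq> 0" "qpoch (A * q / C) q k \<noteq> 0"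
      using den[THEN qpoch_nonzero_mono] by auto
    then show "?w k
      * (qpoch B q k * qpoch C q k * g ^ k / (qpoch (A * q / B) q k * qpoch (A * q / C) q k))
      * \<phi> k = (\<Sum>j\<le>k. f k j)"
      using q_saalschuetz_inverted[OF q nz _ _ g, of k]
      by (simp only: f_def sum_distrib_left sum_distrib_right not_False_eq_True)
  qed simp
  also have "\<dots> = (\<Sum>j\<le>m. \<Sum>i\<le>m - j. f (j + i) j)"
    by (rule sum_triangle_shift)
  also have "\<dots> = ?rhs"
    unfolding sum_distrib_left
  proof (intro sum.cong refl)
    fix j i
    \<comment> \<open>Both sides are splittings of \<open>(A;q)_(2*j+i)\<close>. The second one
      produces the new base \<open>A*q^(2*j)\<close>.\<close>
    have p: "qpoch A q (j + i) * qpoch (A * q ^ (j + i)) q j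
        = qpoch A q (2 * j) * qpoch (A * q ^ (2 * j)) q i"
      unfolding qpoch_add[symmetric] by (simp add: mult_2 add_ac)
    \<comment> \<open>Together with the cross term \<open>j*i\<close> of the binomial coefficient,
      this absorbs the denominator \<open>q^((j+i)*j)\<close> and leaves
      \<open>q^(i choose 2)\<close>.\<close>
    have "2 * (j choose 2) + j = j * j"
      by (induction j) (simp_all add: choose_two_Suc)
    then have "(j + i choose 2) + (j choose 2) + j = (i choose 2) + (j + i) * j"
      by (simp add: choose_two_add algebra_simps)
    then have exps: "q ^ (j + i choose 2) * q ^ (j choose 2) * q ^ j = q ^ (i choose 2) * q ^ ((j + i) * j)"
      by (metis power_add)
    have signs: "(- 1) ^ (j + i) * (- 1) ^ j = ((- 1) ^ i :: complex)"
      by (simp add: power_add flip: power_mult_distrib)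
    have "(- 1) ^ (j + i) * q ^ (j + i choose 2)
        * ((- 1) ^ j * q ^ (j choose 2) * q ^ j / q ^ ((j + i) * j))
      = ((- 1) ^ (j + i) * (- 1) ^ j)
        * (q ^ (j + i choose 2) * q ^ (j choose 2) * q ^ j) / q ^ ((j + i) * j)"
      by (simp add: mult_ac)
    then have c: "(- 1) ^ (j + i) * q ^ (j + i choose 2)
        * ((- 1) ^ j * q ^ (j choose 2) * q ^ j / q ^ ((j + i) * j))
      = (- 1) ^ i * q ^ (i choose 2)"
      unfolding exps signs using q(1) by simp
    have "f (j + i) j = (1 - A * q ^ (2 * (j + i)))
        * ((- 1) ^ (j + i) * q ^ (j + i choose 2)
            * ((- 1) ^ j * q ^ (j choose 2) * q ^ j / q ^ ((j + i) * j)))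
        * (qpoch A q (j + i) * qpoch (A * q ^ (j + i)) q j) / qpoch q q i * qpoch g q j
        / (qpoch q q j * qpoch (A * q / B) q j * qpoch (A * q / C) q j) * \<phi> (j + i)"
      unfolding f_def using qq[of "j + i"] by (simp add: mult_ac)
    also have "\<dots> = qpoch g q j * qpoch A q (2 * j)
        / (qpoch q q j * qpoch (A * q / B) q j * qpoch (A * q / C) q j)
        * ((1 - A * q ^ (2 * j) * q ^ (2 * i)) * qpoch (A * q ^ (2 * j)) q i
             * (- 1) ^ i * q ^ (i choose 2) / qpoch q q i * \<phi> (j + i))"
      unfolding c p by (simp add: power_add mult_ac)
    finally show "f (j + i) j = \<dots>" .
  qed
  finally show ?thesis .
qed

text \<open>This is the summation of \<open>4W3\<close> multiplied by \<open>qpoch A q (2 * m + 1)\<close>, so that no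
  denominator depends on \<open>A\<close>.\<close>

lemma vwp_sum_delta:
  assumes q: "\<And>k. k > 0 \<Longrightarrow> q ^ k \<noteq> 1"
  shows "(\<Sum>i\<le>m. (1 - A * q ^ (2 * i)) * qpoch A q i * (- 1) ^ i * q ^ (i choose 2) / qpoch q q i
      * (qpoch (A * q ^ (m + i + 1)) q (m - i) / qpoch q q (m - i)))
    = (if m = 0 then 1 - A else 0)"
proof (cases m)
  case (Suc n)
  \<comment> \<open>Antidifference of \<open>(1 - q^m) * t i\<close>. Its factor with base
    \<open>A*q^(m+i)\<close> has length \<open>m + 1 - i\<close>, one more than the corresponding
    factor in \<open>t i\<close>.\<close>
  define G where "G i = (1 - q ^ i) * qpoch A q i * (- 1) ^ i * q ^ (i choose 2) / qpoch q q i
      * (qpoch (A * q ^ (m + i)) q (m + 1 - i) / qpoch q q (m - i))" for i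
  define t where "t i = (1 - A * q ^ (2 * i)) * qpoch A q i * (- 1) ^ i * q ^ (i choose 2) / qpoch q q i
      * (qpoch (A * q ^ (m + i + 1)) q (m - i) / qpoch q q (m - i))" for i
  have qq: "1 - q * q ^ j \<noteq> 0" for j using q[of "Suc j"] by simp
  have G: "G i = qpoch A q i * (- 1) ^ i * q ^ (i choose 2) / qpoch q q i
      * (qpoch (A * q ^ (m + i + 1)) q (m - i) / qpoch q q (m - i))
      * ((1 - q ^ i) * (1 - A * q ^ (m + i)))" if "i \<le> m" for i
  proof -
    have "1 + (m - i) = m + 1 - i" using that by simp
    then have "qpoch (A * q ^ (m + i)) q (m + 1 - i)
        = (1 - A * q ^ (m + i)) * qpoch (A * q ^ (m + i + 1)) q (m - i)"
      using qpoch_add[of "A * q ^ (m + i)" q 1 "m - i"] by (simp add: qpoch_Suc mult_ac)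
    then show ?thesis by (simp add: G_def)
  qed
  have "(1 - q ^ m) * t i = G i - G (Suc i)" if im: "i < m" for i
  proof -
    obtain d where d: "m = Suc (i + d)" using less_imp_Suc_add[OF im] by auto
    define P where "P = qpoch A q i * (- 1) ^ i * q ^ (i choose 2) / qpoch q q i
      * (qpoch (A * q ^ (m + i + 1)) q (m - i) / qpoch q q (m - i))"
    have "G (Suc i) = - (P * (q ^ i * (1 - q ^ (m - i)) * (1 - A * q ^ i)))"
      using qq[of i] qq[of d]
      by (simp add: G_def P_def d qpoch_Suc choose_two_Suc power_add mult_ac)
    moreover have "(1 - q ^ m) * (1 - A * q ^ (2 * i))
       = (1 - q ^ i) * (1 - A * q ^ (m + i)) + q ^ i * (1 - q ^ (m - i)) * (1 - A * q ^ i)"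
    proof -
      have s: "q ^ (2 * i) = q ^ i * q ^ i" by (simp add: mult_2 power_add)
      show ?thesis unfolding s by (simp add: d algebra_simps power_add)
    qed
    then have "P * ((1 - q ^ m) * (1 - A * q ^ (2 * i)))
       = P * ((1 - q ^ i) * (1 - A * q ^ (m + i)) + q ^ i * (1 - q ^ (m - i)) * (1 - A * q ^ i))"
      by simp
    moreover have "(1 - q ^ m) * t i = P * ((1 - q ^ m) * (1 - A * q ^ (2 * i)))"
      by (simp add: t_def P_def)
    moreover have "G i = P * ((1 - q ^ i) * (1 - A * q ^ (m + i)))"
      using G[of i] im by (simp add: P_def)
    ultimately show ?thesis by (simp add: distrib_left)
  qed
  then have "(\<Sum>i<m. (1 - q ^ m) * t i) = (\<Sum>i<m. G i - G (Suc i))"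
    by simp
  also have "\<dots> = - G m"
    using sum_lessThan_telescope'[of G m] by (simp add: G_def)
  \<comment> \<open>The telescoping stops before \<open>i = m\<close>. The omitted last term equals
    the boundary value and cancels it.\<close>
  also have "G m = (1 - q ^ m) * t m"
    using G[of m] by (simp add: t_def mult_2)
  finally have "(1 - q ^ m) * (\<Sum>i\<le>m. t i) = 0"
    by (simp add: sum_distrib_left distrib_left flip: lessThan_Suc_atMost)
  then show ?thesis using q[of m] Suc by (simp add: t_def)
qed (simp add: numeral_2_eq_2)

text \<open>Take the termination factor alone as \<open>\<phi>\<close> in
  \<open>bailey_swap\<close>. Every inner sum is then a \<open>vwp_sum_delta\<close> of length
  \<open>m - j\<close>, and only \<open>j = m\<close> survives.\<close>

lemma terminating_6W5:
  assumes q: "q \<noteq> 0" "\<And>k. k > 0 \<Longrightarrow> q ^ k \<noteq> 1"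
    and nz: "A \<noteq> 0" "D \<noteq> 0" "E \<noteq> 0"
    and den: "qpoch (A * q / D) q m \<noteq> 0" "qpoch (A * q / E) q m \<noteq> 0"
    and h: "h = A * q / (D * E)"
  shows "(\<Sum>k\<le>m. (1 - A * q ^ (2 * k)) * qpoch A q k * (- 1) ^ k * q ^ (k choose 2) / qpoch q q k
      * (qpoch D q k * qpoch E q k * h ^ k / (qpoch (A * q / D) q k * qpoch (A * q / E) q k))
      * (qpoch (A * q ^ (m + k + 1)) q (m - k) / qpoch q q (m - k)))
    = qpoch A q (2 * m + 1) * qpoch h q m
      / (qpoch q q m * qpoch (A * q / D) q m * qpoch (A * q / E) q m)"
    (is "?lhs = _")
proof -
  define F where "F j = qpoch h q j * qpoch A q (2 * j)
      / (qpoch q q j * qpoch (A * q / D) q j * qpoch (A * q / E) q j)" for j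
  define S where "S j = (\<Sum>i\<le>m - j. (1 - A * q ^ (2 * j) * q ^ (2 * i)) * qpoch (A * q ^ (2 * j)) q i
             * (- 1) ^ i * q ^ (i choose 2) / qpoch q q i
             * (qpoch (A * q ^ (m + (j + i) + 1)) q (m - (j + i)) / qpoch q q (m - (j + i))))" for j
  have S: "S j = (if j = m then 1 - A * q ^ (2 * m) else 0)" if "j \<le> m" for j
  proof -
    \<comment> \<open>Relative to the new base \<open>A*q^(2*j)\<close> the termination factor is
      the one belonging to length \<open>m - j\<close>.\<close>
    have "A * q ^ (m + (j + i) + 1) = A * q ^ (2 * j) * q ^ ((m - j) + i + 1)" for i
    proof -
      have "m + (j + i) + 1 = 2 * j + ((m - j) + i + 1)" using that by simp
      then show ?thesis by (simp only: power_add[of q "2 * j"] mult.assoc)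
    qed
    then show ?thesis
      using vwp_sum_delta[OF q(2), where m = "m - j" and A = "A * q ^ (2 * j)"] that
      by (simp only: S_def diff_diff_left) auto
  qed
  have "?lhs = (\<Sum>j\<le>m. F j * S j)"
    unfolding F_def S_def by (rule bailey_swap[OF q nz den h])
  also have "\<dots> = (\<Sum>j\<le>m. F j * (if j = m then 1 - A * q ^ (2 * m) else 0))"
    by (intro sum.cong refl) (simp add: S)
  also have "\<dots> = F m * (1 - A * q ^ (2 * m))"
    by (simp add: if_distrib[of "(*) _"] cong: if_cong)
  finally show ?thesis by (simp add: F_def qpoch_Suc mult_ac)
qed

text \<open>Expand the pair \<open>B\<close>, \<open>C\<close> and sum the inner series by
  \<open>terminating_6W5\<close> with parameters \<open>A*q^(2*j)\<close>, \<open>D*q^j\<close>,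
  \<open>E*q^j\<close>. This shift leaves \<open>h\<close> unchanged and turns \<open>A*q/D\<close>
  and \<open>A*q/E\<close> into \<open>A*q/D*q^j\<close> and \<open>A*q/E*q^j\<close>, so the
  denominators complete to index \<open>m\<close>. What remains is a balanced 4phi3 in convolution
  form.\<close>

lemma watson_convolution:
  assumes q: "q \<noteq> 0" "\<And>k. k > 0 \<Longrightarrow> q ^ k \<noteq> 1"
    and nz: "A \<noteq> 0" "B \<noteq> 0" "C \<noteq> 0" "D \<noteq> 0" "E \<noteq> 0"
    and den: "qpoch (A * q / B) q m \<noteq> 0" "qpoch (A * q / C) q m \<noteq> 0"
      "qpoch (A * q / D) q m \<noteq> 0" "qpoch (A * q / E) q m \<noteq> 0"
    and g: "g = A * q / (B * C)" and h: "h = A * q / (D * E)"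
  shows "(\<Sum>k\<le>m. (1 - A * q ^ (2 * k)) * qpoch A q k * (- 1) ^ k * q ^ (k choose 2) / qpoch q q k
      * (qpoch B q k * qpoch C q k * g ^ k / (qpoch (A * q / B) q k * qpoch (A * q / C) q k))
      * ((qpoch D q k * qpoch E q k * h ^ k / (qpoch (A * q / D) q k * qpoch (A * q / E) q k))
          * (qpoch (A * q ^ (m + k + 1)) q (m - k) / qpoch q q (m - k))))
    = qpoch A q (2 * m + 1) / (qpoch (A * q / D) q m * qpoch (A * q / E) q m)
      * (\<Sum>j\<le>m. qpoch g q j * qpoch D q j * qpoch E q j * h ^ j
          / (qpoch q q j * qpoch (A * q / B) q j * qpoch (A * q / C) q j)
          * (qpoch h q (m - j) / qpoch q q (m - j)))"
    (is "?lhs = _")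
proof -
  define S where "S j = (\<Sum>i\<le>m - j. (1 - A * q ^ (2 * j) * q ^ (2 * i)) * qpoch (A * q ^ (2 * j)) q i
             * (- 1) ^ i * q ^ (i choose 2) / qpoch q q i
      * ((qpoch D q (j + i) * qpoch E q (j + i) * h ^ (j + i)
            / (qpoch (A * q / D) q (j + i) * qpoch (A * q / E) q (j + i)))
          * (qpoch (A * q ^ (m + (j + i) + 1)) q (m - (j + i)) / qpoch q q (m - (j + i)))))" for j
  have S: "S j = qpoch D q j * qpoch E q j * h ^ j
      * qpoch (A * q ^ (2 * j)) q (2 * (m - j) + 1) * (qpoch h q (m - j) / qpoch q q (m - j))
      / (qpoch (A * q / D) q m * qpoch (A * q / E) q m)" if "j \<le> m" for j
  proof -
    let ?A = "A * q ^ (2 * j)" and ?D = "D * q ^ j" and ?E = "E * q ^ j"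
    have e: "A * q ^ (m + (j + i) + 1) = ?A * q ^ ((m - j) + i + 1)" for i
    proof -
      have "m + (j + i) + 1 = 2 * j + ((m - j) + i + 1)" using that by simp
      then show ?thesis by (simp only: power_add[of q "2 * j"] mult.assoc)
    qed
    have dd: "?A * q / ?D = A * q / D * q ^ j" "?A * q / ?E = A * q / E * q ^ j"
      using q(1) by (simp_all add: mult_2 power_add)
    have sp: "qpoch (A * q / D) q m = qpoch (A * q / D) q j * qpoch (?A * q / ?D) q (m - j)"
       "qpoch (A * q / E) q m = qpoch (A * q / E) q j * qpoch (?A * q / ?E) q (m - j)"
      unfolding dd by (rule qpoch_split[OF that])+
    have den': "qpoch (?A * q / ?D) q (m - j) \<noteq> 0" "qpoch (?A * q / ?E) q (m - j) \<noteq> 0"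
      using den(3,4) unfolding sp by simp_all
    have nz': "?A \<noteq> 0" "?D \<noteq> 0" "?E \<noteq> 0" using q(1) nz by simp_all
    have h': "h = ?A * q / (?D * ?E)"
      using q(1) by (simp add: h mult_2 power_add)
    have "S j = (\<Sum>i\<le>m - j. qpoch D q j * qpoch E q j * h ^ j / (qpoch (A * q / D) q j * qpoch (A * q / E) q j)
      * ((1 - ?A * q ^ (2 * i)) * qpoch ?A q i * (- 1) ^ i * q ^ (i choose 2) / qpoch q q i
      * (qpoch ?D q i * qpoch ?E q i * h ^ i / (qpoch (?A * q / ?D) q i * qpoch (?A * q / ?E) q i))
      * (qpoch (?A * q ^ ((m - j) + i + 1)) q (m - j - i) / qpoch q q (m - j - i))))"
      unfolding S_def dd e qpoch_add power_add[of h] diff_diff_left by (intro sum.cong refl) (simp add: mult_ac)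
    also have "\<dots> = qpoch D q j * qpoch E q j * h ^ j / (qpoch (A * q / D) q j * qpoch (A * q / E) q j)
      * (qpoch ?A q (2 * (m - j) + 1) * qpoch h q (m - j)
      / (qpoch q q (m - j) * qpoch (?A * q / ?D) q (m - j) * qpoch (?A * q / ?E) q (m - j)))"
      unfolding sum_distrib_left[symmetric]
      by (simp only: terminating_6W5[OF q nz' den' h'])
    finally show ?thesis unfolding sp by (simp add: mult_ac)
  qed
  \<comment> \<open>The lengths add up to \<open>2*m + 1\<close> for every \<open>j\<close>, so this
    factor leaves the sum.\<close>
  have A: "qpoch A q (2 * j) * qpoch (A * q ^ (2 * j)) q (2 * (m - j) + 1) = qpoch A q (2 * m + 1)"
    if "j \<le> m" for j
  proof -
    have "2 * j + (2 * (m - j) + 1) = 2 * m + 1" using that by simp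
    then show ?thesis by (simp only: qpoch_add[symmetric])
  qed
  have "?lhs = (\<Sum>j\<le>m. qpoch g q j * qpoch A q (2 * j)
        / (qpoch q q j * qpoch (A * q / B) q j * qpoch (A * q / C) q j) * S j)"
    unfolding S_def
    by (rule bailey_swap[OF q nz(1-3) den(1,2) g, where \<phi> = "\<lambda>k.
          qpoch D q k * qpoch E q k * h ^ k / (qpoch (A * q / D) q k * qpoch (A * q / E) q k)
          * (qpoch (A * q ^ (m + k + 1)) q (m - k) / qpoch q q (m - k))"])
  also have "\<dots> = (\<Sum>j\<le>m. qpoch A q (2 * m + 1)
      / (qpoch (A * q / D) q m * qpoch (A * q / E) q m)
      * (qpoch g q j * qpoch D q j * qpoch E q j * h ^ j
          / (qpoch q q j * qpoch (A * q / B) q j * qpoch (A * q / C) q j)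
          * (qpoch h q (m - j) / qpoch q q (m - j))))"
  proof (intro sum.cong refl)
    fix j assume "j \<in> {..m}"
    then have j: "j \<le> m" by simp
    show "qpoch g q j * qpoch A q (2 * j)
        / (qpoch q q j * qpoch (A * q / B) q j * qpoch (A * q / C) q j) * S j
      = qpoch A q (2 * m + 1) / (qpoch (A * q / D) q m * qpoch (A * q / E) q m)
      * (qpoch g q j * qpoch D q j * qpoch E q j * h ^ j
          / (qpoch q q j * qpoch (A * q / B) q j * qpoch (A * q / C) q j)
          * (qpoch h q (m - j) / qpoch q q (m - j)))"
      unfolding S[OF j] A[OF j, symmetric] by (simp add: mult_ac)
  qed
  finally show ?thesis by (simp only: sum_distrib_left)
qed

section \<open>Watson's transformation for the series \<open>vwp_W\<close>\<close>

lemma vwp_W_terminating: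
  assumes "q \<noteq> 0" "1 / q ^ m \<in> set as"
  shows "vwp_W a1 as q z =
    (\<Sum>k\<le>m. (1 - a1 * q ^ (2 * k)) / (1 - a1) *
           (qpochs (a1 # as) q k / qpochs (vwp_denoms a1 as q) q k) * z ^ k)"
  unfolding vwp_W_def
proof (rule suminf_finite)
  fix k assume "k \<notin> {..m}"
  then have "qpoch (1 / q ^ m) q k = 0"
    using qpoch_inverse_power_eq_0[OF assms(1)] by simp
  then have "qpochs (a1 # as) q k = 0"
    using assms(2) unfolding qpochs_def by (force simp: prod_list_zero_iff)
  then show "(1 - a1 * q ^ (2 * k)) / (1 - a1) *
      (qpochs (a1 # as) q k / qpochs (vwp_denoms a1 as q) q k) * z ^ k = 0" by simp
qed simp

text \<open>This is \<open>watson_convolution\<close> divided by its normalisation. The argument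
  \<open>z\<close> is the usual \<open>A^2 * q^(m+2) / (B*C*D*E)\<close>. The equations name the
  derived parameters, so that an instance can state them in simplified form.\<close>

lemma watson:
  assumes q: "q \<noteq> 0" "\<And>k. k > 0 \<Longrightarrow> q ^ k \<noteq> 1"
    and nz: "A \<noteq> 0" "B \<noteq> 0" "C \<noteq> 0" "D \<noteq> 0" "E \<noteq> 0"
    and eqs: "A * q / B = B'" "A * q / C = C'" "A * q / D = D'" "A * q / E = E'"
      "A * q / (B * C) = g" "A * q / (D * E) = h" "g * h * q ^ m = z"
    and den: "qpoch B' q m \<noteq> 0" "qpoch C' q m \<noteq> 0" "qpoch D' q m \<noteq> 0" "qpoch E' q m \<noteq> 0"
      "A \<noteq> 1" "qpoch (A * q ^ (m + 1)) q m \<noteq> 0"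
  shows "vwp_W A [B, C, D, E, 1 / q ^ m] q z
    = qpoch (A * q) q m * qpoch q q m / (qpoch D' q m * qpoch E' q m)
      * (\<Sum>j\<le>m. qpoch g q j * qpoch D q j * qpoch E q j * h ^ j
          / (qpoch q q j * qpoch B' q j * qpoch C' q j)
          * (qpoch h q (m - j) / qpoch q q (m - j)))"
proof -
  define K where "K = qpoch q q m / ((1 - A) * qpoch (A * q ^ (m + 1)) q m)"
  define t where "t k = (1 - A * q ^ (2 * k)) * qpoch A q k * (- 1) ^ k * q ^ (k choose 2) / qpoch q q k
      * (qpoch B q k * qpoch C q k * g ^ k / (qpoch B' q k * qpoch C' q k))
      * ((qpoch D q k * qpoch E q k * h ^ k / (qpoch D' q k * qpoch E' q k))
          * (qpoch (A * q ^ (m + k + 1)) q (m - k) / qpoch q q (m - k)))" for k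
  have "vwp_W A [B, C, D, E, 1 / q ^ m] q z = (\<Sum>k\<le>m. K * t k)"
  proof (subst vwp_W_terminating[OF q(1), where m = m], simp, intro sum.cong refl)
    fix k assume "k \<in> {..m}"
    then have k: "k \<le> m" by simp
    \<comment> \<open>The denominator partner of \<open>q^(-m)\<close> is \<open>A*q^(m+1)\<close>.
      Completing its factorial to index \<open>m\<close> replaces division by
      \<open>(A*q^(m+1);q)_k\<close> by the complementary factor in \<open>t k\<close>.\<close>
    have a: "qpoch (A * q ^ (m + 1)) q m
        = qpoch (A * q ^ (m + 1)) q k * qpoch (A * q ^ (m + k + 1)) q (m - k)"
      using qpoch_split[OF k, of "A * q ^ (m + 1)" q] by (simp add: power_add mult_ac)
    then have a': "qpoch (A * q ^ (m + k + 1)) q (m - k) / qpoch (A * q ^ (m + 1)) q m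
        = 1 / qpoch (A * q ^ (m + 1)) q k"
      using den(6) by (auto simp: divide_simps)
    have last: "A * q / (1 / q ^ m) = A * q ^ (m + 1)" by simp
    have inv: "qpoch (1 / q ^ m) q k
        = (- 1) ^ k * q ^ (k choose 2) / q ^ (m * k) * (qpoch q q m / qpoch q q (m - k))"
      by (rule qpoch_inverse_power[OF q k])
    have zk: "z ^ k = g ^ k * h ^ k * q ^ (m * k)"
      by (simp add: eqs(7)[symmetric] power_mult_distrib power_mult)
    have "K * t k = (1 - A * q ^ (2 * k)) / (1 - A) * (qpoch A q k * (- 1) ^ k * q ^ (k choose 2)
      * (qpoch q q m / qpoch q q (m - k))
      * (qpoch B q k * qpoch C q k * qpoch D q k * qpoch E q k)
      / (qpoch q q k * (qpoch B' q k * qpoch C' q k * qpoch D' q k * qpoch E' q k)))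
      * (qpoch (A * q ^ (m + k + 1)) q (m - k) / qpoch (A * q ^ (m + 1)) q m) * (g ^ k * h ^ k)"
      by (simp add: K_def t_def mult_ac)
    also have "\<dots> = (1 - A * q ^ (2 * k)) / (1 - A) *
       (qpochs (A # [B, C, D, E, 1 / q ^ m]) q k
         / qpochs (vwp_denoms A [B, C, D, E, 1 / q ^ m] q) q k) * z ^ k"
      unfolding a' zk vwp_denoms_def qpochs_def list.map prod_list.Cons prod_list.Nil eqs last
      using q(1) by (simp add: inv mult_ac)
    finally show "(1 - A * q ^ (2 * k)) / (1 - A) *
       (qpochs (A # [B, C, D, E, 1 / q ^ m]) q k
         / qpochs (vwp_denoms A [B, C, D, E, 1 / q ^ m] q) q k) * z ^ k = K * t k" ..
  qed
  also have "\<dots> = K * (\<Sum>k\<le>m. t k)" by (simp only: sum_distrib_left)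
  also have "(\<Sum>k\<le>m. t k) = qpoch A q (2 * m + 1) / (qpoch D' q m * qpoch E' q m)
      * (\<Sum>j\<le>m. qpoch g q j * qpoch D q j * qpoch E q j * h ^ j
          / (qpoch q q j * qpoch B' q j * qpoch C' q j)
          * (qpoch h q (m - j) / qpoch q q (m - j)))"
    using watson_convolution[OF q nz, of m g h] den unfolding eqs t_def by simp
  \<comment> \<open>Split the length as \<open>1 + m + m\<close>: the first and last pieces cancel
    against the denominator of \<open>K\<close>.\<close>
  also have "qpoch A q (2 * m + 1) = (1 - A) * qpoch (A * q) q m * qpoch (A * q ^ (m + 1)) q m"
  proof -
    have "2 * m + 1 = 1 + (m + m)" by simp
    then show ?thesis
      by (simp only: qpoch_add) (simp add: qpoch_Suc mult_ac)
  qed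
  finally show ?thesis
    using den(5,6) by (simp add: K_def)
qed

section \<open>Sears' transformation in convolution form\<close>

text \<open>Saalschuetz expands the factors with \<open>\<alpha>*\<delta>\<close> and
  \<open>\<beta>*\<delta>\<close> into a sum over \<open>j\<close>. After the exchange, the sum over
  \<open>i = k - j\<close> is again Saalschuetz, now with \<open>x*q^j\<close>,
  \<open>\<delta>\<close> and \<open>c\<close> in the roles of \<open>\<alpha>\<close>,
  \<open>\<beta>\<close> and \<open>\<delta>\<close>.\<close>

lemma sears_convolution:
  assumes q: "q \<noteq> 0" "\<And>k. k > 0 \<Longrightarrow> q ^ k \<noteq> 1"
    and den: "qpoch (x * \<delta> * c) q m \<noteq> 0" "qpoch (\<alpha> * \<beta> * \<delta>) q m \<noteq> 0"
  shows "(\<Sum>k\<le>m. qpoch x q k * qpoch (\<alpha> * \<delta>) q k * qpoch (\<beta> * \<delta>) q k * c ^ k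
        / (qpoch q q k * qpoch (x * \<delta> * c) q k * qpoch (\<alpha> * \<beta> * \<delta>) q k)
        * (qpoch c q (m - k) / qpoch q q (m - k)))
    = (\<Sum>j\<le>m. qpoch x q j * qpoch \<alpha> q j * qpoch \<beta> q j * (\<delta> * c) ^ j
        / (qpoch q q j * qpoch (\<alpha> * \<beta> * \<delta>) q j)
        * (qpoch (x * q ^ j * c) q (m - j) * qpoch (\<delta> * c) q (m - j) / qpoch q q (m - j)))
      / qpoch (x * \<delta> * c) q m"
proof -
  let ?e = "x * \<delta> * c" and ?\<gamma> = "\<alpha> * \<beta> * \<delta>"
  define f where "f k j = qpoch x q k * c ^ k / qpoch ?e q k * (qpoch c q (m - k) / qpoch q q (m - k))
      * (qpoch \<alpha> q j * qpoch \<beta> q j / (qpoch q q j * qpoch ?\<gamma> q j)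
            * (qpoch \<delta> q (k - j) / qpoch q q (k - j)) * \<delta> ^ j)" for k j
  have "(\<Sum>k\<le>m. qpoch x q k * qpoch (\<alpha> * \<delta>) q k * qpoch (\<beta> * \<delta>) q k * c ^ k
        / (qpoch q q k * qpoch ?e q k * qpoch ?\<gamma> q k)
        * (qpoch c q (m - k) / qpoch q q (m - k))) = (\<Sum>k\<le>m. \<Sum>j\<le>k. f k j)"
  proof (intro sum.cong refl)
    fix k assume "k \<in> {..m}"
    then have gk: "qpoch ?\<gamma> q k \<noteq> 0" using qpoch_nonzero_mono[OF den(2)] by simp
    show "qpoch x q k * qpoch (\<alpha> * \<delta>) q k * qpoch (\<beta> * \<delta>) q k * c ^ k
        / (qpoch q q k * qpoch ?e q k * qpoch ?\<gamma> q k)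
        * (qpoch c q (m - k) / qpoch q q (m - k)) = (\<Sum>j\<le>k. f k j)"
      unfolding f_def sum_distrib_left[symmetric]
      by (simp only: q_saalschuetz[OF q gk]) (simp add: mult_ac)
  qed
  also have "\<dots> = (\<Sum>j\<le>m. \<Sum>i\<le>m - j. f (j + i) j)"
    by (rule sum_triangle_shift)
  also have "\<dots> = (\<Sum>j\<le>m. qpoch x q j * qpoch \<alpha> q j * qpoch \<beta> q j * (\<delta> * c) ^ j
        / (qpoch q q j * qpoch ?\<gamma> q j)
        * (qpoch (x * q ^ j * c) q (m - j) * qpoch (\<delta> * c) q (m - j) / qpoch q q (m - j))
        / qpoch ?e q m)"
  proof (intro sum.cong refl)
    fix j assume "j \<in> {..m}"
    then have j: "j \<le> m" by simp
    let ?x = "x * q ^ j"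
    have sp: "qpoch ?e q m = qpoch ?e q j * qpoch (?e * q ^ j) q (m - j)"
      by (rule qpoch_split[OF j])
    have e: "?x * \<delta> * c = ?e * q ^ j" by (simp add: mult_ac)
    have den': "qpoch (?x * \<delta> * c) q (m - j) \<noteq> 0" using den(1) unfolding sp e by simp
    have "(\<Sum>i\<le>m - j. f (j + i) j)
      = (\<Sum>i\<le>m - j. qpoch x q j * qpoch \<alpha> q j * qpoch \<beta> q j * (\<delta> * c) ^ j
          / (qpoch q q j * qpoch ?\<gamma> q j) / qpoch ?e q j
        * (qpoch ?x q i * qpoch \<delta> q i / (qpoch q q i * qpoch (?x * \<delta> * c) q i)
            * (qpoch c q (m - j - i) / qpoch q q (m - j - i)) * c ^ i))"
      unfolding f_def e qpoch_add power_add[of c]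
      by (intro sum.cong refl) (simp add: mult_ac power_mult_distrib)
    also have "\<dots> = qpoch x q j * qpoch \<alpha> q j * qpoch \<beta> q j * (\<delta> * c) ^ j
          / (qpoch q q j * qpoch ?\<gamma> q j) / qpoch ?e q j
        * (qpoch (?x * c) q (m - j) * qpoch (\<delta> * c) q (m - j)
            / (qpoch q q (m - j) * qpoch (?x * \<delta> * c) q (m - j)))"
      unfolding sum_distrib_left[symmetric] by (simp only: q_saalschuetz[OF q den'])
    finally show "(\<Sum>i\<le>m - j. f (j + i) j) = qpoch x q j * qpoch \<alpha> q j * qpoch \<beta> q j * (\<delta> * c) ^ j
        / (qpoch q q j * qpoch ?\<gamma> q j)
        * (qpoch (x * q ^ j * c) q (m - j) * qpoch (\<delta> * c) q (m - j) / qpoch q q (m - j))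
        / qpoch ?e q m"
      unfolding sp e by (simp add: mult_ac)
  qed
  finally show ?thesis by (simp only: sum_divide_distrib)
qed

text \<open>Here two convolutions, of lengths \<open>m\<close> and \<open>M\<close>, agree term by
  term up to a factor free of \<open>j\<close>. Rewriting \<open>(q^(-M);q)_j\<close> and
  \<open>(q^(-m);q)_j\<close> exchanges the complementary \<open>q\<close>-factorials; reversing the
  last \<open>j\<close> factors of \<open>(q^(-n);q)_m\<close> and of \<open>(h;q)_M\<close>
  exchanges the remaining ones. In the application \<open>p = a*b\<close> and
  \<open>M = N - n\<close>.\<close>

lemma sears_term_conversion:
  assumes q: "q \<noteq> 0" "\<And>k. k > 0 \<Longrightarrow> q ^ k \<noteq> 1"
    and "j \<le> m" "j \<le> M" "m \<le> n" and p: "p \<noteq> 0"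
    and den: "qpoch (p * q ^ (n + 2)) q j \<noteq> 0" "qpoch (c / q ^ M) q j \<noteq> 0"
  defines "h \<equiv> 1 / (p * q ^ (n + M + 1))"
  assumes h0: "qpoch h q M \<noteq> 0"
  shows "qpoch q q m * (qpoch (1 / q ^ M) q j * (1 / q ^ n) ^ j
      / (qpoch q q j * qpoch (p * q ^ (n + 2)) q j)
      * (qpoch (1 / q ^ M * q ^ j * c) q (m - j) * qpoch (1 / q ^ n) q (m - j) / qpoch q q (m - j)))
    = qpoch (1 / q ^ n) q m * qpoch (c / q ^ M) q m * qpoch q q M / qpoch h q M
      * (qpoch (1 / q ^ m) q j * h ^ j
          / (qpoch q q j * qpoch (q ^ (n - m + 1)) q j * qpoch (c / q ^ M) q j)
          * (qpoch h q (M - j) / qpoch q q (M - j)))"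
proof -
  define y where "y = q ^ (n - m + 1)"
  define \<gamma> where "\<gamma> = p * q ^ (n + 2)"
  define Q where "Q = q ^ (j choose 2)"
  have nz: "y \<noteq> 0" "\<gamma> \<noteq> 0" "Q \<noteq> 0" "h \<noteq> 0" using q(1) p by (simp_all add: y_def \<gamma>_def Q_def h_def)
  have qq: "qpoch q q i \<noteq> 0" for i using qpoch_self_nonzero[OF q(2)] .
  \<comment> \<open>\<open>(y;q)_j\<close> is the tail of the nonzero \<open>q\<close>-factorial of
    index \<open>n - m + j\<close>.\<close>
  have yj: "qpoch y q j \<noteq> 0"
    using qq[of "n - m + j"] qpoch_add[of q q "n - m" j] by (auto simp: y_def)
  have hM: "qpoch h q (M - j) \<noteq> 0" using qpoch_nonzero_mono[OF h0] by simp
  have r1: "qpoch (1 / q ^ M) q j = (- 1) ^ j * Q / q ^ (M * j) * (qpoch q q M / qpoch q q (M - j))"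
    unfolding Q_def by (rule qpoch_inverse_power[OF q \<open>j \<le> M\<close>])
  have r2: "qpoch (1 / q ^ m) q j = (- 1) ^ j * Q / q ^ (m * j) * (qpoch q q m / qpoch q q (m - j))"
    unfolding Q_def by (rule qpoch_inverse_power[OF q \<open>j \<le> m\<close>])
  have e3: "1 / q ^ n * q ^ (m - j) = q / (y * q ^ j)"
  proof -
    have "q ^ n * q = q ^ (m - j) * (y * q ^ j)"
      using assms(3,5) by (simp add: y_def flip: power_add power_Suc2)
    then show ?thesis using q(1) nz by (simp add: field_simps)
  qed
  have r3: "qpoch (1 / q ^ n) q m = qpoch (1 / q ^ n) q (m - j) * ((- 1 / y) ^ j / Q * qpoch y q j)"
    using qpoch_split[of "m - j" m "1 / q ^ n" q] \<open>j \<le> m\<close>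
    unfolding e3 Q_def by (simp add: qpoch_reverse[OF q(1) nz(1)])
  have e4: "h * q ^ (M - j) = q / (\<gamma> * q ^ j)"
  proof -
    have "p * q ^ (n + M + 1) * q = \<gamma> * q ^ j * q ^ (M - j)"
      using assms(4) by (simp add: \<gamma>_def mult.assoc flip: power_add power_Suc2)
    then show ?thesis using q(1) p nz by (simp add: h_def field_simps)
  qed
  have r4: "qpoch h q M = qpoch h q (M - j) * ((- 1 / \<gamma>) ^ j / Q * qpoch \<gamma> q j)"
    using qpoch_split[of "M - j" M h q] \<open>j \<le> M\<close>
    unfolding e4 Q_def by (simp add: qpoch_reverse[OF q(1) nz(2)])
  have r5: "qpoch (c / q ^ M) q m = qpoch (c / q ^ M) q j * qpoch (1 / q ^ M * q ^ j * c) q (m - j)"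
    using qpoch_split[OF \<open>j \<le> m\<close>, of "c / q ^ M" q] by (simp add: mult_ac)
  \<comment> \<open>Both sides are \<open>q^(1-M)\<close>. This identity makes the
    \<open>j\<close>-th powers left over from the reversals match.\<close>
  have "\<gamma> * h = y * q ^ m * (1 / q ^ M * (1 / q ^ n))"
  proof -
    have "y * q ^ m = q ^ (n + 1)" using \<open>m \<le> n\<close> by (simp add: y_def flip: power_add)
    then show ?thesis using q(1) p by (simp add: \<gamma>_def h_def power_add)
  qed
  then have c: "1 / q ^ M * (1 / q ^ n) = (- 1 / y) / (- 1 / \<gamma>) / q ^ m * h"
    using q(1) nz by (simp add: field_simps)
  have "1 / q ^ (M * j) * (1 / q ^ n) ^ j = (1 / q ^ M * (1 / q ^ n)) ^ j"
    by (simp add: power_mult power_divide power_mult_distrib)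
  also have "\<dots> = (- 1 / y) ^ j / (- 1 / \<gamma>) ^ j / q ^ (m * j) * h ^ j"
    unfolding c by (simp only: power_mult_distrib power_mult power_divide)
  finally have coef: "1 / q ^ (M * j) * (1 / q ^ n) ^ j
      = (- 1 / y) ^ j / (- 1 / \<gamma>) ^ j / q ^ (m * j) * h ^ j" .
  have "qpoch q q m * (qpoch (1 / q ^ M) q j * (1 / q ^ n) ^ j
      / (qpoch q q j * qpoch \<gamma> q j)
      * (qpoch (1 / q ^ M * q ^ j * c) q (m - j) * qpoch (1 / q ^ n) q (m - j) / qpoch q q (m - j)))
    = (1 / q ^ (M * j) * (1 / q ^ n) ^ j) * ((- 1) ^ j * Q * (qpoch q q M / qpoch q q (M - j))
      / (qpoch q q j * qpoch \<gamma> q j) * (qpoch (1 / q ^ M * q ^ j * c) q (m - j)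
      * qpoch (1 / q ^ n) q (m - j) * (qpoch q q m / qpoch q q (m - j))))"
    unfolding r1 by (simp add: mult_ac)
  also have "\<dots> = qpoch (1 / q ^ n) q m * qpoch (c / q ^ M) q m * qpoch q q M / qpoch h q M
      * (qpoch (1 / q ^ m) q j * h ^ j
          / (qpoch q q j * qpoch y q j * qpoch (c / q ^ M) q j)
          * (qpoch h q (M - j) / qpoch q q (M - j)))"
    unfolding coef r2 r3 r4 r5 using nz hM yj den by (simp add: mult_ac)
  finally show ?thesis unfolding \<gamma>_def y_def .
qed

section \<open>Matching the two series\<close>

text \<open>Watson's transformation treats the pairs \<open>B, C\<close> and \<open>D, E\<close>
  differently. This symmetry of the series gives the choice of the pair to be expanded.\<close>

lemma vwp_W_swap_pairs: "vwp_W A [B, C, D, E, x] q z = vwp_W A [D, E, B, C, x] q z"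
  by (simp add: vwp_W_def vwp_denoms_def qpochs_def mult_ac)

lemma sum_atMost_truncate:
  fixes f :: "nat \<Rightarrow> 'a::comm_monoid_add"
  assumes "\<And>k. k > M \<Longrightarrow> f k = 0"
  shows "(\<Sum>k\<le>m. f k) = (\<Sum>k\<le>min m M. f k)"
  by (rule sum.mono_neutral_right) (auto intro!: assms)

theorem theorem2p4:
  fixes q a b c :: complex and N n m :: nat
  assumes "0 < norm q" and "norm q < 1"
    and "n \<le> N" and "m \<le> n" and "0 < m"
    and "a \<noteq> 0" and "b \<noteq> 0" and "c \<noteq> 0"
    and "vwp_defined_upto (a * b * q)
           [b * q, a * q / c, a * b * q ^ (N + 2), q powi (- int n), q powi (- int m)] q m"
    and "vwp_defined_upto (c * q powi (2 * int n - int N))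
           [c * q powi (int m + int n - int N), q ^ (1 + n), a * q ^ (1 + n),
            b * c * q ^ (1 + n), q powi (int n - int N)] q (N - n)"
    and "qpochs [q powi (- 1 - int N) / (a * b), c * q powi (2 * int n - int N + 1)] q (N - n) \<noteq> 0"
    and "qpochs [a * q, q powi (- int N), b * c * q] q m \<noteq> 0"
  shows
    "vwp_W (a * b * q)
       [b * q, a * q / c, a * b * q ^ (N + 2), q powi (- int n), q powi (- int m)]
       q (c * q powi (int m + int n - int N))
     = (qpochs [c * q powi (int n - int N) / a, q powi (int n - int N) / b] q (N - n) *
        qpochs [a * b * q ^ 2, q powi (- int n), c * q powi (int n - int N)] q m) /
       (qpochs [q powi (- 1 - int N) / (a * b), c * q powi (2 * int n - int N + 1)] q (N - n) *
        qpochs [a * q, q powi (- int N), b * c * q] q m) *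
       vwp_W (c * q powi (2 * int n - int N))
         [c * q powi (int m + int n - int N), q ^ (1 + n), a * q ^ (1 + n),
          b * c * q ^ (1 + n), q powi (int n - int N)]
         q (1 / (a * b * q ^ (1 + n + m)))"
proof -
  have q: "q \<noteq> 0" using assms(1) by auto
  have q1: "q ^ k \<noteq> 1" if "k > 0" for k
  proof
    assume "q ^ k = 1"
    then have "norm q ^ k = 1" by (metis norm_one norm_power)
    then show False using power_strict_mono[of "norm q" 1 k] assms(2) that by simp
  qed
  note qs = q q1
  obtain M where N: "N = n + M" using assms(3) le_Suc_ex by blast
  have M: "N - n = M" by (simp add: N)
  have pw: "q powi (- int n) = 1 / q ^ n" "q powi (- int m) = 1 / q ^ m"
    "q powi (- int N) = 1 / q ^ N"
    "q powi (int m + int n - int N) = q ^ m / q ^ M"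
    "q powi (int n - int N) = 1 / q ^ M"
    "q powi (2 * int n - int N) = q ^ n / q ^ M"
    "q powi (2 * int n - int N + 1) = q * q ^ n / q ^ M"
    "q powi (- 1 - int N) = 1 / q ^ (N + 1)"
  proof -
    have *: "q powi (int i - int k) = q ^ i / q ^ k" for i k
      using q by (simp add: power_int_diff)
    have "- int n = int 0 - int n" "- int m = int 0 - int m" "- int N = int 0 - int N"
      "int m + int n - int N = int m - int M" "int n - int N = int 0 - int M"
      "2 * int n - int N = int n - int M" "2 * int n - int N + 1 = int (Suc n) - int M"
      "- 1 - int N = int 0 - int (N + 1)"
      by (simp_all add: N)
    then show "q powi (- int n) = 1 / q ^ n" "q powi (- int m) = 1 / q ^ m"
      "q powi (- int N) = 1 / q ^ N"
      "q powi (int m + int n - int N) = q ^ m / q ^ M"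
      "q powi (int n - int N) = 1 / q ^ M"
      "q powi (2 * int n - int N) = q ^ n / q ^ M"
      "q powi (2 * int n - int N + 1) = q * q ^ n / q ^ M"
      "q powi (- 1 - int N) = 1 / q ^ (N + 1)"
      by (simp_all only: *) simp_all
  qed
  \<comment> \<open>\<open>\<alpha>\<close> and \<open>\<beta>\<close> are numerator parameters of
    the right-hand series, with base \<open>A\<close>. They occur in both final sums
    \<open>F\<close> and \<open>G\<close> and need no conversion.\<close>
  define \<alpha> where "\<alpha> = b * c * q ^ (1 + n)"
  define \<beta> where "\<beta> = a * q ^ (1 + n)"
  define \<gamma> where "\<gamma> = a * b * q ^ (n + 2)"
  define y where "y = q ^ (n - m + 1)"
  define h where "h = 1 / (a * b * q ^ (n + M + 1))"
  define A where "A = c * (q ^ n / q ^ M)"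
  \<comment> \<open>\<open>e1\<close> and \<open>e2\<close> list the derived parameters in the order
    of the equations of \<open>watson\<close>, for the left and the right series. The last entry of
    each, and the denominators in general, serve to read off the nonvanishing conditions.\<close>
  have e1: "a * b * q * q / (a * b * q ^ (N + 2)) = 1 / q ^ N" "a * b * q * q / (1 / q ^ n) = \<gamma>"
    "a * b * q * q / (b * q) = a * q" "a * b * q * q / (a * q / c) = b * c * q"
    "a * b * q * q / (a * b * q ^ (N + 2) * (1 / q ^ n)) = 1 / q ^ M"
    "a * b * q * q / (b * q * (a * q / c)) = c" "1 / q ^ M * c * q ^ m = c * (q ^ m / q ^ M)"
    "a * b * q * q / (1 / q ^ m) = a * b * q * q ^ (m + 1)"
    using q assms(6-8) by (simp_all add: \<gamma>_def N power_add field_simps power2_eq_square)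
  have e2: "A * q / (c * (q ^ m / q ^ M)) = y" "A * q / q ^ (1 + n) = c / q ^ M"
    "A * q / \<beta> = c * (1 / q ^ M) / a" "A * q / \<alpha> = 1 / q ^ M / b"
    "A * q / (c * (q ^ m / q ^ M) * q ^ (1 + n)) = 1 / q ^ m"
    "A * q / (\<beta> * \<alpha>) = h" "1 / q ^ m * h * q ^ M = 1 / (a * b * q ^ (1 + n + m))"
    "A * q / (1 / q ^ M) = A * q ^ (M + 1)"
    using q assms(4,6-8)
    by (simp_all add: A_def \<alpha>_def \<beta>_def y_def h_def power_add power_diff field_simps)
  have d1: "a * b * q \<noteq> 1" "qpoch (1 / q ^ N) q m \<noteq> 0" "qpoch \<gamma> q m \<noteq> 0"
    "qpoch (a * q) q m \<noteq> 0" "qpoch (b * c * q) q m \<noteq> 0"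
    "qpoch (a * b * q * q ^ (m + 1)) q m \<noteq> 0"
    using assms(9) unfolding vwp_defined_upto_def vwp_denoms_def qpochs_def pw list.map e1
    by auto
  have d2: "A \<noteq> 1" "qpoch y q M \<noteq> 0" "qpoch (c / q ^ M) q M \<noteq> 0"
    "qpoch (c * (1 / q ^ M) / a) q M \<noteq> 0" "qpoch (1 / q ^ M / b) q M \<noteq> 0"
    "qpoch (A * q ^ (M + 1)) q M \<noteq> 0"
    using assms(10)
    unfolding vwp_defined_upto_def vwp_denoms_def qpochs_def pw list.map M
      A_def[symmetric] \<alpha>_def[symmetric] \<beta>_def[symmetric] e2
    by auto
  have h: "1 / q ^ (N + 1) / (a * b) = h" "c * (q * q ^ n / q ^ M) = A * q"
    by (simp_all add: h_def A_def N mult_ac)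
  have d3: "qpoch h q M \<noteq> 0" "qpoch (A * q) q M \<noteq> 0"
    using assms(11) unfolding qpochs_def pw M h by auto
  \<comment> \<open>\<open>F\<close> arises from the left series by Watson followed by Sears,
    \<open>G\<close> from the right series by Watson alone.\<close>
  define F where "F j = qpoch (1 / q ^ M) q j * qpoch \<alpha> q j * qpoch \<beta> q j * (1 / q ^ n) ^ j
        / (qpoch q q j * qpoch \<gamma> q j)
        * (qpoch (1 / q ^ M * q ^ j * c) q (m - j) * qpoch (1 / q ^ n) q (m - j) / qpoch q q (m - j))" for j
  define G where "G j = qpoch (1 / q ^ m) q j * qpoch \<beta> q j * qpoch \<alpha> q j * h ^ j
          / (qpoch q q j * qpoch y q j * qpoch (c / q ^ M) q j)
          * (qpoch h q (M - j) / qpoch q q (M - j))" for j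
  have W1: "vwp_W (a * b * q) [b * q, a * q / c, a * b * q ^ (N + 2), 1 / q ^ n, 1 / q ^ m] q
      (c * (q ^ m / q ^ M))
    = qpoch (a * b * q * q) q m * qpoch q q m / (qpoch (a * q) q m * qpoch (b * c * q) q m)
      * (\<Sum>j\<le>m. F j) / qpoch (1 / q ^ N) q m"
  proof -
    \<comment> \<open>Chosen so that Sears' transformation carries \<open>b*q\<close> and
      \<open>a*q/c\<close> to \<open>\<alpha>\<close> and \<open>\<beta>\<close>.\<close>
    define \<delta> where "\<delta> = 1 / (q ^ n * c)"
    have e: "\<alpha> * \<delta> = b * q" "\<beta> * \<delta> = a * q / c" "\<alpha> * \<beta> * \<delta> = \<gamma>" "1 / q ^ M * \<delta> * c = 1 / q ^ N"
      "\<delta> * c = 1 / q ^ n"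
      using q assms(6-8)
      by (simp_all add: \<alpha>_def \<beta>_def \<gamma>_def \<delta>_def N power_add power2_eq_square)
    \<comment> \<open>With \<open>a*b*q^(N+2)\<close> and \<open>q^(-n)\<close> as the expanded
      pair, the parameters \<open>g\<close> and \<open>h\<close> of Watson become
      \<open>q^(-M)\<close> and \<open>c\<close>.\<close>
    have "vwp_W (a * b * q) [a * b * q ^ (N + 2), 1 / q ^ n, b * q, a * q / c, 1 / q ^ m] q
      (c * (q ^ m / q ^ M))
    = qpoch (a * b * q * q) q m * qpoch q q m / (qpoch (a * q) q m * qpoch (b * c * q) q m)
      * (\<Sum>j\<le>m. qpoch (1 / q ^ M) q j * qpoch (b * q) q j * qpoch (a * q / c) q j * c ^ j
          / (qpoch q q j * qpoch (1 / q ^ N) q j * qpoch \<gamma> q j)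
          * (qpoch c q (m - j) / qpoch q q (m - j)))"
      by (rule watson[OF qs _ _ _ _ _ e1(1-7) d1(2-5,1,6)]) (use q assms(6-8) in simp_all)
    also have "(\<Sum>j\<le>m. qpoch (1 / q ^ M) q j * qpoch (b * q) q j * qpoch (a * q / c) q j * c ^ j
          / (qpoch q q j * qpoch (1 / q ^ N) q j * qpoch \<gamma> q j)
          * (qpoch c q (m - j) / qpoch q q (m - j))) = (\<Sum>j\<le>m. F j) / qpoch (1 / q ^ N) q m"
      using sears_convolution[OF qs, of "1 / q ^ M" \<delta> c m \<alpha> \<beta>] d1(2,3)
      unfolding e F_def by simp
    finally show ?thesis by (subst vwp_W_swap_pairs) simp
  qed
  have W2: "vwp_W A [c * (q ^ m / q ^ M), q ^ (1 + n), \<beta>, \<alpha>, 1 / q ^ M] q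
      (1 / (a * b * q ^ (1 + n + m)))
    = qpoch (A * q) q M * qpoch q q M / (qpoch (c * (1 / q ^ M) / a) q M * qpoch (1 / q ^ M / b) q M)
      * (\<Sum>j\<le>M. G j)"
    unfolding G_def
    by (rule watson[OF qs _ _ _ _ _ e2(1-7) d2(2-5,1,6)])
      (use q assms(6-8) in \<open>simp_all add: A_def \<alpha>_def \<beta>_def\<close>)
  have FG: "qpoch q q m * (\<Sum>j\<le>m. F j)
    = qpoch (1 / q ^ n) q m * qpoch (c / q ^ M) q m * qpoch q q M / qpoch h q M * (\<Sum>j\<le>M. G j)"
  proof -
    \<comment> \<open>\<open>F\<close> vanishes beyond \<open>M\<close> through
      \<open>q^(-M)\<close> and \<open>G\<close> beyond \<open>m\<close> through
      \<open>q^(-m)\<close>, so both sums reduce to the range where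
      \<open>sears_term_conversion\<close> applies.\<close>
    have "(\<Sum>j\<le>m. F j) = (\<Sum>j\<le>min m M. F j)"
      by (rule sum_atMost_truncate) (simp add: F_def qpoch_inverse_power_eq_0[OF q])
    moreover have "(\<Sum>j\<le>M. G j) = (\<Sum>j\<le>min m M. G j)"
      by (subst min.commute, rule sum_atMost_truncate) (simp add: G_def qpoch_inverse_power_eq_0[OF q])
    moreover have "qpoch q q m * F j
      = qpoch (1 / q ^ n) q m * qpoch (c / q ^ M) q m * qpoch q q M / qpoch h q M * G j"
      if "j \<le> min m M" for j
    proof -
      have j: "j \<le> m" "j \<le> M" using that by auto
      have "qpoch \<gamma> q j \<noteq> 0" "qpoch (c / q ^ M) q j \<noteq> 0"
        using qpoch_nonzero_mono[OF d1(3) j(1)] qpoch_nonzero_mono[OF d2(3) j(2)] by auto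
      moreover have "a * b \<noteq> 0" using assms(6,7) by simp
      ultimately have "qpoch q q m * (qpoch (1 / q ^ M) q j * (1 / q ^ n) ^ j
          / (qpoch q q j * qpoch \<gamma> q j)
          * (qpoch (1 / q ^ M * q ^ j * c) q (m - j) * qpoch (1 / q ^ n) q (m - j) / qpoch q q (m - j)))
        = qpoch (1 / q ^ n) q m * qpoch (c / q ^ M) q m * qpoch q q M / qpoch h q M
        * (qpoch (1 / q ^ m) q j * h ^ j
          / (qpoch q q j * qpoch y q j * qpoch (c / q ^ M) q j)
          * (qpoch h q (M - j) / qpoch q q (M - j)))" (is "?l = ?r")
        using sears_term_conversion[OF qs j assms(4), of "a * b" c] d3(1)
        unfolding \<gamma>_def h_def y_def by simp
      then have "?l * (qpoch \<alpha> q j * qpoch \<beta> q j) = ?r * (qpoch \<alpha> q j * qpoch \<beta> q j)" by simp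
      then show ?thesis unfolding F_def G_def by (simp add: mult_ac)
    qed
    ultimately show ?thesis by (simp add: sum_distrib_left)
  qed
  have "qpoch (a * b * q * q) q m * qpoch q q m / (qpoch (a * q) q m * qpoch (b * c * q) q m)
      * (\<Sum>j\<le>m. F j) / qpoch (1 / q ^ N) q m
    = qpoch (a * b * q * q) q m / (qpoch (a * q) q m * qpoch (b * c * q) q m * qpoch (1 / q ^ N) q m)
      * (qpoch q q m * (\<Sum>j\<le>m. F j))"
    by (simp add: mult_ac)
  \<comment> \<open>The prefactor of \<open>W2\<close> is split off, so that the last factor is
    exactly the right-hand series.\<close>
  also have "\<dots> = qpoch (c * (1 / q ^ M) / a) q M * qpoch (1 / q ^ M / b) q M
      * (qpoch (a * b * q * q) q m * qpoch (1 / q ^ n) q m * qpoch (c / q ^ M) q m)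
      / (qpoch h q M * qpoch (A * q) q M
         * (qpoch (a * q) q m * qpoch (1 / q ^ N) q m * qpoch (b * c * q) q m))
      * (qpoch (A * q) q M * qpoch q q M
        / (qpoch (c * (1 / q ^ M) / a) q M * qpoch (1 / q ^ M / b) q M) * (\<Sum>j\<le>M. G j))"
    unfolding FG using d2(4,5) d3(2) by (simp add: mult_ac)
  finally show ?thesis
    unfolding pw M h A_def[symmetric] \<alpha>_def[symmetric] \<beta>_def[symmetric] W1 W2 qpochs_def
    by (simp add: power2_eq_square mult_ac)
qed

end
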